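(* Let $\rho=p/q$ be a rational number ($p\in\mathbb{Z}$, $q\geq 1$ an integer) and let $\widetilde f\in\widetilde{\mathrm{End}}_0(\mathbb{T})$ be such that $\widetilde f^{q}-p\neq\mathrm{Id}$. Then one of the following situations occurs: - there exists a neighborhood $\mathcal U$ of $\widetilde f$ in $\widetilde{\mathrm{End}}_0(\mathbb{T})$ such that $\rho\in\rho(\widetilde f')$ for every $\widetilde f'\in\mathcal U$; - there exists a neighborhood $\mathcal U$ of $\widetilde f$ in $\widetilde{\mathrm{End}}_0(\mathbb{T})$ such that $\rho\notin\mathrm{int}(\rho(\widetilde f'))$ for every $\widetilde f'\in\mathcal U$.
   Context: $\mathbb{T}=\mathbb{R}/\mathbb{Z}$. $\mathrm{End}_0(\mathbb{T})$ is the space of continuous maps $f:\mathbb{T}\to\mathbb{T}$ homotopic to the identity and $\widetilde{\mathrm{End}}_0(\mathbb{T})$ is the space of lifts of elements of $\mathrm{End}_0(\mathbb{T})$ to $\mathbb{R}$, i.e. the continuous maps $\widetilde f:\mathbb{R}\to\mathbb{R}$ with $\widetilde f(x+1)=\widetilde f(x)+1$, endowed with the $C^0$ (uniform) topology. The rotation set of $\widetilde f\in\widetilde{\mathrm{End}}_0(\mathbb{T})$ is the compact real segment (possibly a point) $$\rho(\widetilde f)=\bigcap_{i\geq 1}\overline{\bigcup_{n\geq i}\left\{\frac{\widetilde f^n(\widetilde z)-\widetilde z}{n} : \widetilde z\in\mathbb{R}\right\}}.$$ $\mathrm{int}$ denotes the interior in $\mathbb{R}$. *)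

theory Defs
  imports "HOL-Analysis.Analysis"
begin

definition End0_lift :: "(real \<Rightarrow> real) set" where
  "End0_lift = {f. continuous_on UNIV f \<and> (\<forall>x. f (x + 1) = f x + 1)}"

text \<open>
  Lifts are unbounded, but the difference of two lifts is continuous and 1-periodic, hence bounded,
  so on \<^const>\<open>End0_lift\<close> this is the usual uniform distance. Outside that set the value is
  irrelevant; it is set to 0 because \<^locale>\<open>Metric_space\<close> demands nonnegativity everywhere.
\<close>

definition C0_dist :: "(real \<Rightarrow> real) \<Rightarrow> (real \<Rightarrow> real) \<Rightarrow> real" where
  "C0_dist f g = (if f \<in> End0_lift \<and> g \<in> End0_lift then SUP x. \<bar>f x - g x\<bar> else 0)"

lemma End0_lift_bdd_above_diff:
  assumes "f \<in> End0_lift" "g \<in> End0_lift"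
  shows "bdd_above (range (\<lambda>x. \<bar>f x - g x\<bar>))"
proof -
  define h where "h = (\<lambda>x. \<bar>f x - g x\<bar>)"
  have "continuous_on UNIV f" "continuous_on UNIV g"
    using assms by (auto simp: End0_lift_def)
  hence "continuous_on {0..1} h"
    unfolding h_def by (intro continuous_intros) (auto intro: continuous_on_subset)
  hence "compact (h ` {0..1})"
    by (intro compact_continuous_image) auto
  hence bdd: "bdd_above (h ` {0..1})"
    by (intro bounded_imp_bdd_above compact_imp_bounded)
  have step: "h (x + 1) = h x" for x
    using assms by (simp add: h_def End0_lift_def)
  have nat_step: "h (x + real n) = h x" for x n
  proof (induction n)
    case (Suc n)
    have "h (x + real (Suc n)) = h ((x + real n) + 1)" by (simp add: algebra_simps)
    then show ?case using step Suc by simp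
  qed simp
  have int_step: "h (x + of_int k) = h x" for x k
  proof (cases "k \<ge> 0")
    case True
    then show ?thesis using nat_step[of x "nat k"] by simp
  next
    case False
    then show ?thesis using nat_step[of "x + of_int k" "nat (- k)"] by simp
  qed
  have "h x \<in> h ` {0..1}" for x
  proof
    show "h x = h (frac x)"
      using int_step[of "frac x" "\<lfloor>x\<rfloor>"] by (simp add: frac_def)
    show "frac x \<in> {0..1}"
      by (simp add: less_imp_le[OF frac_lt_1])
  qed
  hence "range h \<subseteq> h ` {0..1}" by blast
  with bdd show ?thesis
    unfolding h_def[symmetric] by (rule bdd_above_mono)
qed

lemma abs_diff_le_C0_dist:
  assumes "f \<in> End0_lift" "g \<in> End0_lift"
  shows "\<bar>f x - g x\<bar> \<le> C0_dist f g"
  using cSUP_upper[OF UNIV_I End0_lift_bdd_above_diff[OF assms], of x] assms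
  by (simp add: C0_dist_def)

lemma C0_dist_le:
  assumes "f \<in> End0_lift" "g \<in> End0_lift" "\<And>x. \<bar>f x - g x\<bar> \<le> c"
  shows "C0_dist f g \<le> c"
  using assms by (auto simp: C0_dist_def intro: cSUP_least)

interpretation End0: Metric_space End0_lift C0_dist
proof
  fix f g :: "real \<Rightarrow> real"
  show "0 \<le> C0_dist f g"
  proof (cases "f \<in> End0_lift \<and> g \<in> End0_lift")
    case True
    then have "\<bar>f 0 - g 0\<bar> \<le> C0_dist f g" by (intro abs_diff_le_C0_dist) auto
    then show ?thesis by linarith
  qed (auto simp: C0_dist_def)
  show "C0_dist f g = C0_dist g f"
    by (auto simp: C0_dist_def abs_minus_commute)
next
  fix f g :: "real \<Rightarrow> real"
  assume fg: "f \<in> End0_lift" "g \<in> End0_lift"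
  show "C0_dist f g = 0 \<longleftrightarrow> f = g"
  proof
    assume "C0_dist f g = 0"
    then have "\<bar>f x - g x\<bar> \<le> 0" for x
      using abs_diff_le_C0_dist[OF fg, of x] by simp
    then show "f = g" by (intro ext) auto
  qed (auto simp: C0_dist_def)
next
  fix f g h :: "real \<Rightarrow> real"
  assume fgh: "f \<in> End0_lift" "g \<in> End0_lift" "h \<in> End0_lift"
  show "C0_dist f h \<le> C0_dist f g + C0_dist g h"
  proof (rule C0_dist_le[OF fgh(1,3)])
    fix x
    show "\<bar>f x - h x\<bar> \<le> C0_dist f g + C0_dist g h"
      using abs_diff_le_C0_dist[OF fgh(1,2), of x] abs_diff_le_C0_dist[OF fgh(2,3), of x]
      by linarith
  qed
qed

abbreviation C0_topology :: "(real \<Rightarrow> real) topology" where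
  "C0_topology \<equiv> End0.mtopology"

definition neighborhood_in :: "'a topology \<Rightarrow> 'a \<Rightarrow> 'a set \<Rightarrow> bool" where
  "neighborhood_in X a U \<longleftrightarrow> U \<subseteq> topspace X \<and> (\<exists>V. openin X V \<and> a \<in> V \<and> V \<subseteq> U)"

definition rotation_set :: "(real \<Rightarrow> real) \<Rightarrow> real set" where
  "rotation_set f =
     (\<Inter>i\<in>{1::nat..}. closure (\<Union>n\<in>{i..}. {((f ^^ n) z - z) / real n | z. z \<in> UNIV}))"

end

theory Submission
  imports Defs
begin

text \<open>
  Write \<open>F = f\<^sup>q - p\<close>, so that \<open>F \<noteq> Id\<close>, and let \<open>\<phi> = F - Id\<close>, a continuous periodic function
  which is not identically zero. Uniform continuity of \<open>f\<close> makes \<open>g\<^sup>q - p\<close> uniformly close to \<open>F\<close>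
  when \<open>g\<close> is uniformly close to \<open>f\<close> (\<open>funpow_C0_close\<close>).

  If \<open>\<phi>\<close> takes both signs, so does \<open>G - Id\<close> for \<open>G = g\<^sup>q - p\<close> with \<open>g\<close> close to \<open>f\<close>. Hence \<open>G\<close> has a
  fixed point, that is, \<open>g\<^sup>q z = z + p\<close> for some \<open>z\<close>, and \<open>p/q\<close> is in the rotation set of \<open>g\<close>: the
  first alternative holds.

  Otherwise \<open>\<phi>\<close> has a constant sign, say \<open>\<phi> \<ge> 0\<close>, and \<open>\<phi> > \<eta> > 0\<close> on some interval \<open>[a, a + r]\<close>.
  Take \<open>G\<close> at distance less than \<open>min \<eta> r\<close> from \<open>F\<close>. A point of \<open>[a, a + r]\<close> moves to the right under
  \<open>G\<close>, and a point to the right of \<open>a + r\<close> moves to the left by less than \<open>r\<close>, if at all. Thus no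
  orbit of \<open>G\<close> crosses \<open>a\<close> from right to left, although \<open>G\<close> may well move many points to the left. By
  periodicity the integer translates of \<open>a\<close> are also barriers, so an orbit never drifts to the left
  by more than 1, and the rotation set of \<open>g\<close> lies in \<open>[p/q, \<infinity>)\<close> (\<open>rotation_set_ge_near\<close>). Then \<open>p/q\<close>
  is not an interior point: the second alternative holds. The case \<open>\<phi> \<le> 0\<close> follows by conjugation
  with \<open>x \<mapsto> -x\<close>.
\<close>

section \<open>Lifts of degree one\<close>

lemma End0_lift_add_int:
  assumes "f \<in> End0_lift"
  shows "f (x + of_int k) = f x + of_int k"
proof -
  have step: "f (y + 1) = f y + 1" for y
    using assms by (simp add: End0_lift_def)
  show ?thesis
  proof (induction k rule: int_induct[where k = 0])
    case (step1 i)
    then show ?case using step[of "x + of_int i"] by (simp add: algebra_simps)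
  next
    case (step2 i)
    then show ?case using step[of "x + of_int (i - 1)"] by (simp add: algebra_simps)
  qed simp
qed

lemma End0_lift_funpow:
  assumes "f \<in> End0_lift"
  shows "f ^^ n \<in> End0_lift"
proof (induction n)
  case 0
  then show ?case by (simp add: End0_lift_def)
next
  case (Suc n)
  then have "continuous_on UNIV (f \<circ> f ^^ n)"
    using assms unfolding End0_lift_def
    by (intro continuous_on_compose) (auto intro: continuous_on_subset)
  then show ?case
    using Suc assms by (simp add: End0_lift_def o_def)
qed

lemma End0_lift_diff_int:
  assumes "f \<in> End0_lift"
  shows "(\<lambda>x. f x - of_int k) \<in> End0_lift"
  using assms by (auto simp: End0_lift_def intro!: continuous_intros)

lemma funpow_diff_int:
  assumes "f \<in> End0_lift"
  shows "((\<lambda>x. (f ^^ m) x - of_int k) ^^ n) x = (f ^^ (m * n)) x - of_int (int n * k)"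
proof (induction n)
  case (Suc n)
  have "(f ^^ m) ((f ^^ (m * n)) x - of_int (int n * k)) - of_int k
      = (f ^^ m) ((f ^^ (m * n)) x) - of_int (int n * k) - of_int k"
    using End0_lift_add_int[OF End0_lift_funpow[OF assms], of m _ "- (int n * k)"] by simp
  also have "\<dots> = (f ^^ (m * Suc n)) x - of_int (int (Suc n) * k)"
    by (simp add: funpow_add algebra_simps)
  finally show ?case using Suc.IH by simp
qed simp

lemma End0_lift_displacement_bounded:
  assumes "f \<in> End0_lift"
  obtains B where "0 \<le> B" "\<And>x. \<bar>f x - x\<bar> \<le> B"
proof -
  have "(\<lambda>x. x) \<in> End0_lift" by (simp add: End0_lift_def)
  from abs_diff_le_C0_dist[OF assms this] have B: "\<bar>f x - x\<bar> \<le> C0_dist f (\<lambda>x. x)" for x .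
  moreover from B[of 0] have "0 \<le> C0_dist f (\<lambda>x. x)" by linarith
  ultimately show ?thesis using that by blast
qed

lemma funpow_displacement:
  fixes f :: "real \<Rightarrow> real"
  assumes "\<And>x. \<bar>f x - x\<bar> \<le> B"
  shows "\<bar>(f ^^ n) x - x\<bar> \<le> real n * B"
proof (induction n)
  case (Suc n)
  then show ?case using assms[of "(f ^^ n) x"] by (simp add: algebra_simps)
qed simp

lemma End0_lift_uniformly_continuous:
  assumes "f \<in> End0_lift" "e > 0"
  obtains d where "d > 0" "\<And>x y. \<bar>x - y\<bar> < d \<Longrightarrow> \<bar>f x - f y\<bar> < e"
proof -
  have "continuous_on {-1..2} f"
    using assms by (auto simp: End0_lift_def intro: continuous_on_subset)
  then have "uniformly_continuous_on {-1..2} f"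
    by (rule compact_uniformly_continuous) simp
  then obtain d where d: "d > 0"
    "\<And>x y. \<lbrakk>x \<in> {-1..2}; y \<in> {-1..2}; dist y x < d\<rbrakk> \<Longrightarrow> dist (f y) (f x) < e"
    unfolding uniformly_continuous_on_def using \<open>e > 0\<close> by metis
  show ?thesis
  proof (rule that[of "min d 1"])
    fix x y :: real assume xy: "\<bar>x - y\<bar> < min d 1"
    define k where "k = - \<lfloor>x\<rfloor>"
    have "x + of_int k \<in> {-1..2}" "y + of_int k \<in> {-1..2}"
      unfolding k_def atLeastAtMost_iff using xy floor_correct[of x] by simp_all linarith+
    then have "dist (f (x + of_int k)) (f (y + of_int k)) < e"
      using xy by (intro d) (auto simp: dist_real_def)
    then show "\<bar>f x - f y\<bar> < e"
      by (simp add: End0_lift_add_int[OF assms(1)] dist_real_def)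
  qed (use d in auto)
qed

text \<open>
  In the induction step \<open>f\<close>, not \<open>g\<close>, is applied to the two nearby points \<open>f\<^sup>n x\<close> and \<open>g\<^sup>n x\<close>.
  Only the modulus of continuity of \<open>f\<close> enters, so \<open>d\<close> is independent of \<open>g\<close>.
\<close>

lemma funpow_C0_close:
  assumes "f \<in> End0_lift" "e > 0"
  shows "\<exists>d>0. \<forall>g. (\<forall>x. \<bar>f x - g x\<bar> < d) \<longrightarrow> (\<forall>x. \<bar>(f ^^ n) x - (g ^^ n) x\<bar> < e)"
  using \<open>e > 0\<close>
proof (induction n arbitrary: e)
  case 0
  then show ?case by (auto intro: exI[of _ 1])
next
  case (Suc n)
  obtain d1 where d1: "d1 > 0" "\<And>x y. \<bar>x - y\<bar> < d1 \<Longrightarrow> \<bar>f x - f y\<bar> < e / 2"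
    using End0_lift_uniformly_continuous[OF assms(1), of "e / 2"] Suc.prems by auto
  obtain d2 where d2: "d2 > 0"
    "\<And>g. \<forall>x. \<bar>f x - g x\<bar> < d2 \<Longrightarrow> \<forall>x. \<bar>(f ^^ n) x - (g ^^ n) x\<bar> < d1"
    using Suc.IH[OF d1(1)] by blast
  show ?case
  proof (intro exI[of _ "min d2 (e / 2)"] conjI allI impI)
    fix g x assume g: "\<forall>x. \<bar>f x - g x\<bar> < min d2 (e / 2)"
    then have "\<bar>(f ^^ n) x - (g ^^ n) x\<bar> < d1" using d2(2)[of g] by simp
    from d1(2)[OF this] have "\<bar>f ((f ^^ n) x) - f ((g ^^ n) x)\<bar> < e / 2" .
    moreover have "\<bar>f ((g ^^ n) x) - g ((g ^^ n) x)\<bar> < e / 2" using g by simp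
    ultimately have "\<bar>f ((f ^^ n) x) - g ((g ^^ n) x)\<bar> < e" by linarith
    then show "\<bar>(f ^^ Suc n) x - (g ^^ Suc n) x\<bar> < e" by simp
  qed (use d2 Suc.prems in auto)
qed

section \<open>Locating a rational number relative to the rotation set\<close>

lemma rotation_set_periodic:
  assumes "g \<in> End0_lift" "q \<ge> 1" "(g ^^ q) z = z + of_int p"
  shows "of_int p / of_nat q \<in> rotation_set g"
  unfolding rotation_set_def
proof (intro INT_I subsetD[OF closure_subset])
  fix i :: nat assume i: "i \<in> {1..}"
  have "((\<lambda>x. (g ^^ q) x - of_int p) ^^ i) z = z"
    by (induction i) (auto simp: assms(3))
  then have "(g ^^ (q * i)) z = z + of_int (int i * p)"
    using funpow_diff_int[OF assms(1),
      where m = q and k = p and n = i and x = z] by simp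
  then have "((g ^^ (q * i)) z - z) / real (q * i) = of_int p / of_nat q"
    using i by (simp add: field_simps)
  moreover have "q * i \<in> {i..}" using assms(2) by simp
  ultimately show "of_int p / of_nat q \<in> (\<Union>n\<in>{i..}. {((g ^^ n) z - z) / real n | z. z \<in> UNIV})"
    by (smt (verit) UN_iff UNIV_I mem_Collect_eq)
qed

text \<open>
  The bound on the iterates of \<open>g\<^sup>q\<close> controls every iterate: \<open>g\<^sup>m\<close> and the nearest earlier
  iterate of \<open>g\<^sup>q\<close> differ by fewer than \<open>q\<close> steps, each of bounded length. So \<open>g\<^sup>m z - z\<close> falls
  below \<open>m p / q\<close> by at most a constant, which disappears after division by \<open>m\<close>.
\<close>

lemma rotation_set_ge:
  assumes g: "g \<in> End0_lift" and q: "q \<ge> 1"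
    and low: "\<And>n x. ((\<lambda>x. (g ^^ q) x - of_int p) ^^ n) x \<ge> x - C"
  shows "rotation_set g \<subseteq> {of_int p / of_nat q..}"
proof
  fix y assume y: "y \<in> rotation_set g"
  define \<rho> where "\<rho> = real_of_int p / real q"
  obtain B where B: "0 \<le> B" "\<And>x. \<bar>g x - x\<bar> \<le> B"
    using End0_lift_displacement_bounded[OF g] by blast
  define K where "K = \<bar>C\<bar> + real q * B + \<bar>real_of_int p\<bar>"
  have iter: "(g ^^ m) z - z \<ge> real m * \<rho> - K" for m z
  proof -
    define n r where "n = m div q" and "r = m mod q"
    have m: "m = r + q * n" and r: "r < q" using q by (auto simp: n_def r_def)
    have "(g ^^ m) z = (g ^^ r) ((g ^^ (q * n)) z)" by (simp add: m funpow_add)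
    moreover have "\<bar>(g ^^ r) w - w\<bar> \<le> real q * B" for w
      using funpow_displacement[of g B r w] B r mult_right_mono[of "real r" "real q" B] by force
    moreover have "(g ^^ (q * n)) z \<ge> z - C + real n * p"
      using low[of z n] funpow_diff_int[OF g,
        where m = q and k = p and n = n and x = z] by simp
    ultimately have "(g ^^ m) z \<ge> z - C + real n * p - real q * B"
      by (smt (verit))
    moreover have "real m * \<rho> = real r * \<rho> + real n * p"
      using q by (simp add: m \<rho>_def field_simps)
    moreover have "real r * \<rho> \<le> \<bar>real_of_int p\<bar>"
    proof -
      have "real r * \<rho> \<le> real r * \<bar>\<rho>\<bar>" by (intro mult_left_mono) auto
      also have "\<dots> \<le> real q * \<bar>\<rho>\<bar>" using r by (intro mult_right_mono) auto
      also have "\<dots> = \<bar>real_of_int p\<bar>" using q by (simp add: \<rho>_def)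
      finally show ?thesis .
    qed
    ultimately show ?thesis unfolding K_def by linarith
  qed
  have K: "K \<ge> 0" using B by (simp add: K_def)
  have bound: "y \<ge> \<rho> - K / real i" if i: "i \<ge> 1" for i
  proof -
    have "((g ^^ n) z - z) / real n \<ge> \<rho> - K / real i" if "n \<ge> i" for n z
    proof -
      have "\<rho> - K / real i \<le> \<rho> - K / real n"
        using that i K by (simp add: frac_le)
      also have "\<dots> = (real n * \<rho> - K) / real n" using that i by (simp add: field_simps)
      also have "\<dots> \<le> ((g ^^ n) z - z) / real n" by (intro divide_right_mono iter) simp
      finally show ?thesis .
    qed
    then have "closure (\<Union>n\<in>{i..}. {((g ^^ n) z - z) / real n | z. z \<in> UNIV}) \<subseteq> {\<rho> - K / real i..}"
      by (intro closure_minimal) auto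
    then show ?thesis using y i unfolding rotation_set_def by fastforce
  qed
  have "(\<lambda>i. \<rho> - K / real i) \<longlonglongrightarrow> \<rho> - 0"
    by (intro tendsto_intros lim_const_over_n)
  then have "y \<ge> \<rho> - 0"
    by (rule LIMSEQ_le_const2) (use bound in blast)
  then show "y \<in> {of_int p / of_nat q..}" by (simp add: \<rho>_def)
qed

section \<open>Barriers\<close>

text \<open>
  Every integer translate of \<open>c\<close> is a barrier as well, and an orbit stays to the right of the
  last translate that is not beyond its starting point.
\<close>

lemma barrier_no_left_drift:
  assumes G: "G \<in> End0_lift" and c: "\<And>x. x \<ge> c \<Longrightarrow> G x \<ge> c"
  shows "(G ^^ n) x \<ge> x - 1"
proof -
  define k where "k = \<lfloor>x - c\<rfloor>"
  have "(G ^^ n) (x - of_int k) \<ge> c"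
    by (induction n) (use c in \<open>auto simp: k_def\<close>, linarith)
  moreover have "(G ^^ n) (x - of_int k) = (G ^^ n) x - of_int k"
    using End0_lift_add_int[OF End0_lift_funpow[OF G], of n x "- k"] by simp
  ultimately show ?thesis unfolding k_def by linarith
qed

text \<open>
  The point \<open>a\<close>, at which \<open>f\<^sup>q - p\<close> moves strictly to the right, becomes a barrier for all nearby
  \<open>g\<^sup>q - p\<close>: their leftward steps are shorter than an interval to the right of \<open>a\<close> on which they
  move every point to the right, and so cannot jump over that interval.
\<close>

lemma rotation_set_ge_near:
  assumes f: "f \<in> End0_lift" and q: "q \<ge> 1"
    and nonneg: "\<And>x. (f ^^ q) x - of_int p \<ge> x"
    and pos: "(f ^^ q) a - of_int p > a"
  shows "\<exists>d>0. \<forall>g\<in>End0_lift. (\<forall>x. \<bar>f x - g x\<bar> < d) \<longrightarrow> rotation_set g \<subseteq> {of_int p / of_nat q..}"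
proof -
  define \<phi> where "\<phi> = (\<lambda>x. (f ^^ q) x - of_int p - x)"
  define \<eta> where "\<eta> = \<phi> a / 2"
  have "continuous_on UNIV \<phi>"
    using End0_lift_funpow[OF f, of q] unfolding \<phi>_def End0_lift_def
    by (auto intro!: continuous_intros)
  then have "isCont \<phi> a" by (simp add: continuous_on_eq_continuous_at)
  moreover have \<eta>: "\<eta> > 0" using pos by (simp add: \<eta>_def \<phi>_def)
  ultimately obtain s where s: "s > 0" "\<And>x. dist x a < s \<Longrightarrow> dist (\<phi> x) (\<phi> a) < \<eta>"
    unfolding continuous_at_eps_delta by blast
  define r where "r = s / 2"
  have \<phi>: "\<phi> x > \<eta>" if "x \<in> {a..a + r}" for x
  proof -
    have "dist x a < s" using s(1) that by (simp add: r_def dist_real_def)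
    from s(2)[OF this] show ?thesis unfolding \<eta>_def dist_real_def by linarith
  qed
  have "min \<eta> r > 0" using \<eta> s(1) by (simp add: r_def)
  then obtain d where d: "d > 0"
    "\<And>g. \<forall>x. \<bar>f x - g x\<bar> < d \<Longrightarrow> \<forall>x. \<bar>(f ^^ q) x - (g ^^ q) x\<bar> < min \<eta> r"
    using funpow_C0_close[OF f, of "min \<eta> r" q] by blast
  show ?thesis
  proof (intro exI[of _ d] conjI ballI impI)
    fix g assume g: "g \<in> End0_lift" and near: "\<forall>x. \<bar>f x - g x\<bar> < d"
    have close: "\<bar>(f ^^ q) x - (g ^^ q) x\<bar> < min \<eta> r" for x
      using d(2)[OF near] by blast
    have barrier: "(g ^^ q) x - of_int p \<ge> a" if "x \<ge> a" for x
    proof (cases "x \<le> a + r")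
      case True
      then show ?thesis using \<phi>[of x] that close[of x] unfolding \<phi>_def by (simp, linarith)
    next
      case False
      then show ?thesis using nonneg[of x] close[of x] by (simp, linarith)
    qed
    show "rotation_set g \<subseteq> {of_int p / of_nat q..}"
      by (rule rotation_set_ge[OF g q barrier_no_left_drift])
        (use barrier End0_lift_diff_int[OF End0_lift_funpow[OF g]] in auto)
  qed (use d in auto)
qed

section \<open>Reflection of the line\<close>

definition reflect :: "(real \<Rightarrow> real) \<Rightarrow> real \<Rightarrow> real" where
  "reflect g = (\<lambda>x. - g (- x))"

lemma reflect_funpow: "(reflect g ^^ n) x = - (g ^^ n) (- x)"
  by (induction n) (auto simp: reflect_def)

lemma reflect_End0_lift:
  assumes "g \<in> End0_lift"
  shows "reflect g \<in> End0_lift"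
proof -
  have "continuous_on UNIV (\<lambda>x. - g (- x))"
    using assms unfolding End0_lift_def
    by (intro continuous_on_minus continuous_on_compose2[of UNIV g UNIV uminus] continuous_on_id) auto
  moreover have "- g (- (x + 1)) = - g (- x) + 1" for x
    using End0_lift_add_int[OF assms, of "- x" "- 1"] by simp
  ultimately show ?thesis by (auto simp: End0_lift_def reflect_def)
qed

lemma rotation_set_reflect: "rotation_set (reflect g) = uminus ` rotation_set g"
proof -
  have *: "(\<Union>n\<in>{i..}. {((reflect g ^^ n) z - z) / real n | z. z \<in> UNIV})
      = uminus ` (\<Union>n\<in>{i..}. {((g ^^ n) z - z) / real n | z. z \<in> UNIV})" (is "?L i = uminus ` ?R i") for i
  proof -
    have eq: "((reflect g ^^ n) z - z) / real n = - (((g ^^ n) (- z) - (- z)) / real n)" for n z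
      by (simp add: reflect_funpow diff_divide_distrib add_divide_distrib)
    have "{((reflect g ^^ n) z - z) / real n | z. z \<in> UNIV}
        = uminus ` {((g ^^ n) z - z) / real n | z. z \<in> UNIV}" (is "?A = uminus ` ?B") for n
    proof
      show "?A \<subseteq> uminus ` ?B" unfolding eq by blast
      show "uminus ` ?B \<subseteq> ?A"
      proof clarify
        fix z
        have "- (((g ^^ n) z - z) / real n) = ((reflect g ^^ n) (- z) - (- z)) / real n"
          using eq[of n "- z"] by simp
        then show "\<exists>z'. - (((g ^^ n) z - z) / real n) = ((reflect g ^^ n) z' - z') / real n \<and> z' \<in> UNIV"
          by blast
      qed
    qed
    then show ?thesis by (simp add: image_UN)
  qed
  have closure_uminus: "closure (uminus ` S) = uminus ` closure S" for S :: "real set"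
    by (rule closure_injective_linear_image[symmetric]) (auto simp: linear_uminus)
  show ?thesis
    unfolding rotation_set_def * closure_uminus
    by (rule image_INT[symmetric, where j = 1]) (auto simp: inj_on_def)
qed

lemma rotation_set_le_near:
  assumes f: "f \<in> End0_lift" and q: "q \<ge> 1"
    and nonpos: "\<And>x. (f ^^ q) x - of_int p \<le> x"
    and neg: "(f ^^ q) a - of_int p < a"
  shows "\<exists>d>0. \<forall>g\<in>End0_lift. (\<forall>x. \<bar>f x - g x\<bar> < d) \<longrightarrow> rotation_set g \<subseteq> {..of_int p / of_nat q}"
proof -
  have "(reflect f ^^ q) x - of_int (- p) \<ge> x" for x
    using nonpos[of "- x"] by (simp add: reflect_funpow)
  moreover have "(reflect f ^^ q) (- a) - of_int (- p) > - a"
    using neg by (simp add: reflect_funpow)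
  ultimately obtain d where d: "d > 0"
    "\<And>g. \<lbrakk>g \<in> End0_lift; \<forall>x. \<bar>reflect f x - g x\<bar> < d\<rbrakk>
      \<Longrightarrow> rotation_set g \<subseteq> {of_int (- p) / of_nat q..}"
    using rotation_set_ge_near[OF reflect_End0_lift[OF f] q] by metis
  show ?thesis
  proof (intro exI[of _ d] conjI ballI impI)
    fix g assume g: "g \<in> End0_lift" and near: "\<forall>x. \<bar>f x - g x\<bar> < d"
    have "\<bar>reflect f x - reflect g x\<bar> < d" for x
      using near[rule_format, of "- x"] by (simp add: reflect_def abs_minus_commute)
    then have "uminus ` rotation_set g \<subseteq> {of_int (- p) / of_nat q..}"
      using d(2)[OF reflect_End0_lift[OF g]] by (simp add: rotation_set_reflect)
    then show "rotation_set g \<subseteq> {..of_int p / of_nat q}" by auto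
  qed (use d in auto)
qed

section \<open>The dichotomy\<close>

lemma rotation_set_contains_near:
  assumes f: "f \<in> End0_lift" and q: "q \<ge> 1"
    and pos: "(f ^^ q) a - of_int p > a" and neg: "(f ^^ q) b - of_int p < b"
  shows "\<exists>d>0. \<forall>g\<in>End0_lift. (\<forall>x. \<bar>f x - g x\<bar> < d) \<longrightarrow> of_int p / of_nat q \<in> rotation_set g"
proof -
  define e where "e = min ((f ^^ q) a - of_int p - a) (b - ((f ^^ q) b - of_int p))"
  have "e > 0" using pos neg by (simp add: e_def)
  then obtain d where d: "d > 0"
    "\<And>g. \<forall>x. \<bar>f x - g x\<bar> < d \<Longrightarrow> \<forall>x. \<bar>(f ^^ q) x - (g ^^ q) x\<bar> < e"
    using funpow_C0_close[OF f, of e q] by blast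
  show ?thesis
  proof (intro exI[of _ d] conjI ballI impI)
    fix g assume g: "g \<in> End0_lift" and near: "\<forall>x. \<bar>f x - g x\<bar> < d"
    define \<psi> where "\<psi> = (\<lambda>x. (g ^^ q) x - of_int p - x)"
    have "continuous_on UNIV \<psi>"
      using End0_lift_funpow[OF g, of q] unfolding \<psi>_def End0_lift_def
      by (auto intro!: continuous_intros)
    then have "connected (range \<psi>)" by (intro connected_continuous_image) auto
    moreover have "\<psi> a \<ge> 0" "\<psi> b \<le> 0"
      using d(2)[OF near, rule_format, of a] d(2)[OF near, rule_format, of b]
      by (auto simp: \<psi>_def e_def)
    ultimately have "0 \<in> range \<psi>"
      using connected_contains_Icc[of "range \<psi>" "\<psi> b" "\<psi> a"] by auto
    then obtain z where "\<psi> z = 0" by (metis imageE)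
    then have "(g ^^ q) z = z + of_int p" by (simp add: \<psi>_def)
    then show "of_int p / of_nat q \<in> rotation_set g"
      by (rule rotation_set_periodic[OF g q])
  qed (use d in auto)
qed

lemma neighborhood_in_C0I:
  assumes "f \<in> End0_lift"
    and "\<exists>d>0. \<forall>g\<in>End0_lift. (\<forall>x. \<bar>f x - g x\<bar> < d) \<longrightarrow> P g"
  shows "\<exists>U. neighborhood_in C0_topology f U \<and> (\<forall>g\<in>U. P g)"
proof -
  obtain d where d: "d > 0" "\<And>g. \<lbrakk>g \<in> End0_lift; \<forall>x. \<bar>f x - g x\<bar> < d\<rbrakk> \<Longrightarrow> P g"
    using assms(2) by blast
  have "neighborhood_in C0_topology f (End0.mball f d)"
    unfolding neighborhood_in_def using assms(1) d(1)
    by (auto intro!: exI[of _ "End0.mball f d"])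
  moreover have "P g" if "g \<in> End0.mball f d" for g
    using that abs_diff_le_C0_dist[OF assms(1), of g]
    by (intro d) (auto intro: le_less_trans)
  ultimately show ?thesis by blast
qed

theorem theorem5:
  fixes f :: "real \<Rightarrow> real" and p :: int and q :: nat and \<rho> :: real
  assumes "q \<ge> 1"
    and "\<rho> = of_int p / of_nat q"
    and "f \<in> End0_lift"
    and "(\<lambda>x. (f ^^ q) x - of_int p) \<noteq> id"
  shows "(\<exists>U. neighborhood_in C0_topology f U \<and> (\<forall>g\<in>U. \<rho> \<in> rotation_set g)) \<or>
         (\<exists>U. neighborhood_in C0_topology f U \<and> (\<forall>g\<in>U. \<rho> \<notin> interior (rotation_set g)))"
proof -
  define F where "F = (\<lambda>x. (f ^^ q) x - real_of_int p)"
  obtain c where c: "F c \<noteq> c" using assms(4) by (auto simp: F_def fun_eq_iff)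
  consider (both) a b where "F a > a" "F b < b" | (ge) "\<forall>x. F x \<ge> x" | (le) "\<forall>x. F x \<le> x"
    by (meson not_le)
  then show ?thesis
  proof cases
    case both
    then show ?thesis
      using neighborhood_in_C0I[OF assms(3) rotation_set_contains_near[OF assms(3,1), of a p b]]
      by (simp add: F_def assms(2))
  next
    case ge
    then have "F c > c" using c by (simp add: order_less_le)
    then have "\<exists>d>0. \<forall>g\<in>End0_lift. (\<forall>x. \<bar>f x - g x\<bar> < d) \<longrightarrow> rotation_set g \<subseteq> {\<rho>..}"
      using rotation_set_ge_near[OF assms(3,1), where p = p and a = c] ge by (simp add: F_def assms(2))
    then obtain U where U: "neighborhood_in C0_topology f U" "\<forall>g\<in>U. rotation_set g \<subseteq> {\<rho>..}"
      using neighborhood_in_C0I[OF assms(3), of "\<lambda>g. rotation_set g \<subseteq> {\<rho>..}"] by blast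
    have "\<rho> \<notin> interior (rotation_set g)" if "g \<in> U" for g
      using interior_mono[of "rotation_set g" "{\<rho>..}"] U(2) that by auto
    then show ?thesis using U(1) by blast
  next
    case le
    then have "F c < c" using c by (simp add: order_less_le)
    then have "\<exists>d>0. \<forall>g\<in>End0_lift. (\<forall>x. \<bar>f x - g x\<bar> < d) \<longrightarrow> rotation_set g \<subseteq> {..\<rho>}"
      using rotation_set_le_near[OF assms(3,1), where p = p and a = c] le by (simp add: F_def assms(2))
    then obtain U where U: "neighborhood_in C0_topology f U" "\<forall>g\<in>U. rotation_set g \<subseteq> {..\<rho>}"
      using neighborhood_in_C0I[OF assms(3), of "\<lambda>g. rotation_set g \<subseteq> {..\<rho>}"] by blast
    have "\<rho> \<notin> interior (rotation_set g)" if "g \<in> U" for g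
      using interior_mono[of "rotation_set g" "{..\<rho>}"] U(2) that by auto
    then show ?thesis using U(1) by blast
  qed
qed

end
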